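(* Let $K$ be a field, let $\Lambda_1,\ldots,\Lambda_n\subseteq K$ be finite subsets, let $\Lambda=\Lambda_1\times\cdots\times\Lambda_n\subseteq K^n$ and let $g_i(X_i)=\prod_{a_i\in\Lambda_i}(X_i-a_i)\in K[X_i]\subseteq K[X_1,\ldots,X_n]$ for $i=1,\ldots,n$. Then $\mathrm{I}_K(\Lambda)=\langle g_1(X_1),\ldots,g_n(X_n)\rangle$.
   Context: For a subset $W\subseteq K^n$, $\mathrm{I}_K(W):=\{f\in K[X_1,\ldots,X_n]\mid f(a)=0\text{ for all }a\in W\}$. $\langle\ldots\rangle$ denotes the ideal generated in $K[X_1,\ldots,X_n]$. *)

theory Defs
  imports Complex_Main "HOL-Library.Poly_Mapping" "HOL-Library.FuncSet"
begin

text \<open>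
  Polynomials over \<^typ>\<open>'k\<close> in commuting indeterminates indexed by the type \<^typ>\<open>'n\<close>: finitely
  supported maps from exponent vectors to coefficients, with the convolution product of
  \<open>Poly_Mapping\<close>. For \<open>K[X\<^sub>1,\<dots>,X\<^sub>n]\<close> take \<^typ>\<open>'n\<close> finite with n elements;
  correspondingly, the points of \<open>K\<^sup>n\<close> are the functions \<open>'n \<Rightarrow> 'k\<close>.
\<close>

type_synonym ('n, 'k) mpoly = "('n \<Rightarrow>\<^sub>0 nat) \<Rightarrow>\<^sub>0 'k"

definition mvar :: "'n \<Rightarrow> ('n, 'k::comm_ring_1) mpoly" where
  "mvar i = Poly_Mapping.single (Poly_Mapping.single i 1) 1"

definition mconst :: "'k \<Rightarrow> ('n, 'k::comm_ring_1) mpoly" where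
  "mconst c = Poly_Mapping.single 0 c"

definition meval :: "('n::finite, 'k::comm_ring_1) mpoly \<Rightarrow> ('n \<Rightarrow> 'k) \<Rightarrow> 'k" where
  "meval f a = (\<Sum>m\<in>Poly_Mapping.keys f.
     Poly_Mapping.lookup f m * (\<Prod>i\<in>UNIV. a i ^ Poly_Mapping.lookup m i))"

definition vanishing_ideal :: "('n::finite \<Rightarrow> 'k::field) set \<Rightarrow> ('n, 'k) mpoly set" where
  "vanishing_ideal W = {f. \<forall>a\<in>W. meval f a = 0}"

text \<open>
  A commutative ring is a module over itself; its submodules are its ideals, and the span of a
  set is the ideal generated by it.
\<close>

lemma module_times: "module ((*) :: 'r::comm_ring_1 \<Rightarrow> 'r \<Rightarrow> 'r)"
  by unfold_locales (simp_all add: algebra_simps)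

definition ideal_gen :: "'r::comm_ring_1 set \<Rightarrow> 'r set" where
  "ideal_gen S = module.span (*) S"

lemma meval_mconst: "meval (mconst c) a = c"
  by (cases "c = 0") (simp_all add: meval_def mconst_def)

lemma meval_mvar: "meval (mvar i) a = a i"
proof -
  have "(\<Prod>j\<in>UNIV. a j ^ Poly_Mapping.lookup (Poly_Mapping.single i (1::nat)) j)
      = (\<Prod>j\<in>UNIV. if j = i then a j else 1)"
    by (rule prod.cong) (auto simp: lookup_single when_def)
  then show ?thesis
    by (simp add: meval_def mvar_def)
qed

end

theory Submission
  imports Defs
begin

text \<open>
  Modulo the ideal of a single point \<open>a\<close>, every polynomial \<open>f\<close> is congruent to the constant
  \<open>f(a)\<close>, so a polynomial vanishing on the grid lies in \<open>\<langle>X\<^sub>i - a\<^sub>i | i\<rangle>\<close> for each grid point \<open>a\<close>.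
  Since the elements \<open>X\<^sub>i - c\<close> for distinct \<open>c \<in> \<Lambda>\<^sub>i\<close> are pairwise comaximal, an element that lies
  in \<open>I + \<langle>X\<^sub>i - c\<rangle>\<close> for every such \<open>c\<close> lies in \<open>I + \<langle>g\<^sub>i\<rangle>\<close>. Applying this to one coordinate after
  the other replaces all the generators \<open>X\<^sub>i - a\<^sub>i\<close> by the \<open>g\<^sub>i\<close>.
\<close>

section \<open>Generated ideals and comaximal elements\<close>

lemma ideal_gen_closed:
  "x \<in> ideal_gen B \<Longrightarrow> y \<in> ideal_gen B \<Longrightarrow> x + y \<in> ideal_gen B"
  "x \<in> ideal_gen B \<Longrightarrow> r * x \<in> ideal_gen B"
  "x \<in> ideal_gen B \<Longrightarrow> x * r \<in> ideal_gen B"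
  unfolding ideal_gen_def
  by (simp_all add: module.span_add[OF module_times]
      module.span_scale[OF module_times] mult.commute[of _ r])

lemma ideal_gen_base: "x \<in> B \<Longrightarrow> x \<in> ideal_gen B"
  unfolding ideal_gen_def by (rule module.span_base[OF module_times])

lemma ideal_gen_zero: "0 \<in> ideal_gen B"
  unfolding ideal_gen_def by (rule module.span_zero[OF module_times])

lemma ideal_gen_insert_iff: "x \<in> ideal_gen (insert y B) \<longleftrightarrow> (\<exists>r. x - r * y \<in> ideal_gen B)"
  unfolding ideal_gen_def by (rule module.span_breakdown_eq[OF module_times])

lemma mult_mem_ideal_gen_insert:
  assumes "f \<in> ideal_gen (insert x B)"
  shows "y * f \<in> ideal_gen (insert (x * y) B)"
proof -
  obtain r where "f - r * x \<in> ideal_gen B"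
    using assms by (auto simp: ideal_gen_insert_iff)
  then have "y * (f - r * x) \<in> ideal_gen B"
    by (rule ideal_gen_closed)
  then have "y * f - r * (x * y) \<in> ideal_gen B"
    by (simp add: algebra_simps)
  then show ?thesis
    by (auto simp: ideal_gen_insert_iff)
qed

text \<open>Multiplying the relations \<open>r * y a + s * z = 1\<close> over all \<open>a\<close>
  leaves one term free of \<open>z\<close>, a multiple of the product; all other terms are multiples
  of \<open>z\<close>.\<close>

lemma comaximal_prod:
  fixes y :: "'a \<Rightarrow> 'r::comm_ring_1"
  assumes "\<And>a. a \<in> S \<Longrightarrow> \<exists>r s. r * y a + s * z = 1"
  shows "\<exists>r s. r * prod y S + s * z = 1"
  using assms
proof (induction S rule: infinite_finite_induct)
  case (insert a S)
  obtain r s r' s' where *: "r * y a + s * z = 1" "r' * prod y S + s' * z = 1"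
    using insert by (metis insertCI)
  have "1 = (r * y a + s * z) * (r' * prod y S + s' * z)"
    by (simp add: *)
  also have "\<dots> = r * r' * prod y (insert a S)
      + (s * r' * prod y S + r * y a * s' + s * z * s') * z"
    using insert.hyps by (simp add: algebra_simps)
  finally show ?case
    by metis
\<comment> \<open>For empty or infinite \<open>S\<close> the product is 1 by convention.\<close>
qed (rule exI[of _ 1], rule exI[of _ 0], simp)+

text \<open>Write P for the product over \<open>S\<close>. If \<open>r * P + s * y b = 1\<close>,
  then \<open>f = r * (P * f) + s * (y b * f)\<close>. Each summand lies in the target ideal: the
  factor missing from the generator known for \<open>f\<close> is supplied by the
  multiplier.\<close>

lemma ideal_gen_insert_prod:
  fixes y :: "'a \<Rightarrow> 'r::comm_ring_1"
  assumes "finite S"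
    and "\<And>a b. a \<in> S \<Longrightarrow> b \<in> S \<Longrightarrow> a \<noteq> b \<Longrightarrow> \<exists>r s. r * y a + s * y b = 1"
    and "\<And>a. a \<in> S \<Longrightarrow> f \<in> ideal_gen (insert (y a) B)"
  shows "f \<in> ideal_gen (insert (prod y S) B)"
  using assms
proof (induction S)
  case empty
  \<comment> \<open>The empty product 1 generates the whole ring, so \<open>f\<close> itself serves
    as the coefficient.\<close>
  have "f - f * 1 \<in> ideal_gen B"
    by (simp add: ideal_gen_zero)
  then show ?case
    unfolding ideal_gen_insert_iff prod.empty by blast
next
  case (insert b S)
  have "f \<in> ideal_gen (insert (prod y S) B)"
    using insert by blast
  then have 1: "y b * f \<in> ideal_gen (insert (prod y (insert b S)) B)"
    using insert.hyps mult_mem_ideal_gen_insert[of f "prod y S" B "y b"]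
    by (simp add: mult.commute)
  have "f \<in> ideal_gen (insert (y b) B)"
    using insert by blast
  then have 2: "prod y S * f \<in> ideal_gen (insert (prod y (insert b S)) B)"
    using insert.hyps mult_mem_ideal_gen_insert[of f "y b" B "prod y S"] by simp
  have "\<exists>r s. r * prod y S + s * y b = 1"
    using insert by (intro comaximal_prod) (metis insertCI)
  then obtain r s where "r * prod y S + s * y b = 1"
    by blast
  then have "f = r * (prod y S * f) + s * (y b * f)"
    by (metis distrib_right mult.assoc mult_1)
  then show ?case
    using 1 2 by (metis ideal_gen_closed(1,2))
qed

section \<open>Induction over polynomials\<close>

lemma poly_mapping_sum_single:
  "(\<Sum>k\<in>Poly_Mapping.keys f. Poly_Mapping.single k (Poly_Mapping.lookup f k)) = f"
  by (rule poly_mapping_eqI)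
    (auto simp: lookup_sum lookup_single when_def not_in_keys_iff_lookup_eq_zero)

lemma poly_mapping_add_induct [case_names single add]:
  fixes f :: "'a \<Rightarrow>\<^sub>0 'b::comm_monoid_add"
  assumes "\<And>k v. P (Poly_Mapping.single k v)"
    and "\<And>f g. P f \<Longrightarrow> P g \<Longrightarrow> P (f + g)"
  shows "P f"
proof -
  \<comment> \<open>Zero is a monomial with coefficient 0, so it needs no case of its own.\<close>
  have "P 0"
    using assms(1)[of undefined 0] by simp
  then have "P (\<Sum>k\<in>A. Poly_Mapping.single k (Poly_Mapping.lookup f k))" for A
    by (induction A rule: infinite_finite_induct) (auto intro: assms)
  then show ?thesis
    by (metis poly_mapping_sum_single)
qed

lemma mconst_simps:
  "mconst 0 = 0" "mconst 1 = 1"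
  "mconst (c + d) = mconst c + mconst d"
  "mconst (c - d) = mconst c - mconst d"
  "mconst (c * d) = mconst c * mconst d"
  by (simp_all add: mconst_def single_add single_diff mult_single)

lemma mvar_power: "mvar i ^ n = Poly_Mapping.single (Poly_Mapping.single i n) 1"
  by (induction n) (simp_all add: mvar_def mult_single flip: single_add)

lemma prod_single:
  "(\<Prod>i\<in>A. Poly_Mapping.single (m i) (1::'k::comm_ring_1))
    = Poly_Mapping.single (\<Sum>i\<in>A. m i) 1"
  by (induction A rule: infinite_finite_induct) (simp_all add: mult_single)

lemma single_eq_mconst_mult_mvars:
  fixes m :: "'n::finite \<Rightarrow>\<^sub>0 nat"
  shows "Poly_Mapping.single m c = mconst c * (\<Prod>i\<in>UNIV. mvar i ^ Poly_Mapping.lookup m i)"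
proof -
  have "(\<Sum>i\<in>UNIV. Poly_Mapping.single i (Poly_Mapping.lookup m i)) = m"
    by (rule poly_mapping_eqI) (simp add: lookup_sum lookup_single when_def)
  then show ?thesis
    by (simp add: mvar_power prod_single mconst_def mult_single)
qed

lemma mpoly_induct [case_names mconst mvar add mult]:
  fixes f :: "('n::finite, 'k::comm_ring_1) mpoly"
  assumes const: "\<And>c. P (mconst c)" and var: "\<And>i. P (mvar i)"
    and add: "\<And>f g. P f \<Longrightarrow> P g \<Longrightarrow> P (f + g)"
    and mult: "\<And>f g. P f \<Longrightarrow> P g \<Longrightarrow> P (f * g)"
  shows "P f"
proof (induction f rule: poly_mapping_add_induct)
  case (single m c)
  have one: "P 1"
    using const[of 1] by (simp add: mconst_simps)
  have power: "P (mvar i ^ n)" for i n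
    by (induction n) (simp_all add: one var mult)
  have "P (\<Prod>i\<in>A. mvar i ^ Poly_Mapping.lookup m i)" for A
    by (induction A rule: infinite_finite_induct) (simp_all add: one power mult)
  then show ?case
    unfolding single_eq_mconst_mult_mvars by (intro mult const)
qed (rule add)

section \<open>Evaluation as a ring homomorphism\<close>

lemma meval_superset:
  assumes "finite A" "Poly_Mapping.keys f \<subseteq> A"
  shows "meval f a
    = (\<Sum>m\<in>A. Poly_Mapping.lookup f m * (\<Prod>i\<in>UNIV. a i ^ Poly_Mapping.lookup m i))"
  unfolding meval_def using assms
  by (intro sum.mono_neutral_left) (auto simp: not_in_keys_iff_lookup_eq_zero)

lemma meval_add: "meval (f + g) a = meval f a + meval g a"
proof -
  \<comment> \<open>Cancellation may shrink the support of \<open>f + g\<close>, so all three sums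
    are taken over the union.\<close>
  let ?A = "Poly_Mapping.keys f \<union> Poly_Mapping.keys g"
  have "finite ?A" "Poly_Mapping.keys (f + g) \<subseteq> ?A"
    by (simp_all add: keys_add)
  then show ?thesis
    by (simp add: meval_superset[of ?A] lookup_add distrib_right sum.distrib)
qed

lemma meval_single:
  "meval (Poly_Mapping.single m c) a = c * (\<Prod>i\<in>UNIV. a i ^ Poly_Mapping.lookup m i)"
  by (cases "c = 0") (simp_all add: meval_def)

lemma meval_mult: "meval (f * g) a = meval f a * meval g a"
proof (induction f rule: poly_mapping_add_induct)
  case (single m c)
  show ?case
  proof (induction g rule: poly_mapping_add_induct)
    case (single m' c')
    show ?case
      by (simp only: mult_single meval_single lookup_add power_add prod.distrib ac_simps)
  qed (simp add: meval_add distrib_left)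
qed (simp add: meval_add distrib_right)

lemma meval_diff: "meval (f - g) a = meval f a - meval g a"
  by (metis add_diff_cancel_right' diff_add_cancel meval_add)

lemma meval_one: "meval 1 a = 1"
  by (metis meval_mconst mconst_simps(2))

lemma meval_prod: "meval (prod h A) a = (\<Prod>x\<in>A. meval (h x) a)"
  by (induction A rule: infinite_finite_induct) (simp_all add: meval_one meval_mult)

lemma meval_ideal_gen_eq_0:
  assumes "f \<in> ideal_gen B" "\<And>h. h \<in> B \<Longrightarrow> meval h a = 0"
  shows "meval f a = 0"
  using assms(1) unfolding ideal_gen_def
proof (induction rule: module.span_induct_alt[OF module_times, consumes 1, case_names base step])
  case base
  show ?case
    by (metis meval_mconst mconst_simps(1))
qed (simp add: meval_add meval_mult assms(2))

text \<open>Constants and variables satisfy this directly. For products, the telescoping identity fg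
  - f(a)g(a) = (f - f(a))g + f(a)(g - g(a)) carries it over.\<close>

lemma diff_meval_mem_ideal_gen:
  fixes f :: "('n::finite, 'k::comm_ring_1) mpoly"
  shows "f - mconst (meval f a) \<in> ideal_gen (range (\<lambda>i. mvar i - mconst (a i)))"
    (is "_ \<in> ?I")
proof (induction f rule: mpoly_induct)
  case (mconst c)
  show ?case
    by (simp add: meval_mconst ideal_gen_zero)
next
  case (mvar i)
  show ?case
    by (simp add: meval_mvar ideal_gen_base)
next
  case (add f g)
  have "f + g - mconst (meval (f + g) a)
      = (f - mconst (meval f a)) + (g - mconst (meval g a))"
    by (simp add: meval_add mconst_simps)
  then show ?case
    using add by (simp only: ideal_gen_closed)
next
  case (mult f g)
  have "f * g - mconst (meval (f * g) a)
      = (f - mconst (meval f a)) * g + mconst (meval f a) * (g - mconst (meval g a))"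
    by (simp add: meval_mult mconst_simps algebra_simps)
  then show ?case
    using mult by (simp only: ideal_gen_closed)
qed

text \<open>The two factors differ by the nonzero constant \<open>b - a\<close>, which is invertible
  in a field.\<close>

lemma comaximal_linear_factors:
  fixes a b :: "'k::field"
  assumes "a \<noteq> b"
  shows "\<exists>r s. r * (mvar i - mconst a) + s * (mvar i - mconst b) = 1"
proof -
  let ?c = "mconst (1 / (b - a)) :: ('a, 'k) mpoly"
  have "?c * (mvar i - mconst a) + (- ?c) * (mvar i - mconst b) = ?c * mconst (b - a)"
    by (simp add: mconst_simps algebra_simps)
  also have "\<dots> = 1"
    using assms unfolding mconst_simps(5)[symmetric] by (simp add: mconst_simps(2))
  finally show ?thesis
    by blast
qed

theorem theorem5p1:
  fixes \<Lambda> :: "'n::finite \<Rightarrow> 'k::field set"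
    and g :: "'n \<Rightarrow> ('n, 'k) mpoly"
  assumes "\<And>i. finite (\<Lambda> i)"
    and "\<And>i. g i = (\<Prod>a\<in>\<Lambda> i. mvar i - mconst a)"
  shows "vanishing_ideal (Pi UNIV \<Lambda>) = ideal_gen (g ` UNIV)"
proof
  show "ideal_gen (g ` UNIV) \<subseteq> vanishing_ideal (Pi UNIV \<Lambda>)"
  proof
    fix f assume f: "f \<in> ideal_gen (g ` UNIV)"
    have "meval (g i) a = 0" if "a \<in> Pi UNIV \<Lambda>" for a i
      using that assms(1)[of i]
      by (auto simp: assms(2) meval_prod meval_diff meval_mvar meval_mconst)
    with f show "f \<in> vanishing_ideal (Pi UNIV \<Lambda>)"
      unfolding vanishing_ideal_def by (auto intro: meval_ideal_gen_eq_0)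
  qed
next
  show "vanishing_ideal (Pi UNIV \<Lambda>) \<subseteq> ideal_gen (g ` UNIV)"
  proof
    fix f assume f: "f \<in> vanishing_ideal (Pi UNIV \<Lambda>)"
    \<comment> \<open>Only the coordinates of \<open>a\<close> outside \<open>T\<close> are constrained, so that for \<open>T = UNIV\<close> the claim
      holds for an arbitrary \<open>a\<close>, even if the grid is empty.\<close>
    have "f \<in> ideal_gen (g ` T \<union> (\<lambda>j. mvar j - mconst (a j)) ` (- T))"
      if "a \<in> Pi (- T) \<Lambda>" for T a
      using finite[of T] that
    proof (induction T arbitrary: a)
      case empty
      \<comment> \<open>With \<open>T\<close> empty, \<open>a\<close> is a point of the grid, so
        \<open>f\<close> equals its difference from the constant \<open>meval f a\<close>.\<close>
      then have "meval f a = 0"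
        using f by (simp add: vanishing_ideal_def)
      then show ?case
        using diff_meval_mem_ideal_gen[of f a] by (simp add: mconst_simps)
    next
      case (insert i T)
      let ?B = "g ` T \<union> (\<lambda>j. mvar j - mconst (a j)) ` (- insert i T)"
      have "f \<in> ideal_gen (insert (mvar i - mconst c) ?B)" if "c \<in> \<Lambda> i" for c
      proof -
        \<comment> \<open>The value \<open>a i\<close> is unconstrained here; replacing it by any
          \<open>c\<close> in \<open>\<Lambda> i\<close> makes the induction hypothesis applicable
          and leaves the generators in \<open>?B\<close> unchanged.\<close>
        have "a(i := c) \<in> Pi (- T) \<Lambda>"
          using insert.prems that by auto
        moreover have "- T = insert i (- insert i T)"
          using insert.hyps by auto
        then have "g ` T \<union> (\<lambda>j. mvar j - mconst ((a(i := c)) j)) ` (- T)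
            = insert (mvar i - mconst c) ?B"
          by auto
        ultimately show ?thesis
          using insert.IH by metis
      qed
      then have "f \<in> ideal_gen (insert (g i) ?B)"
        unfolding assms(2)[of i]
        by (intro ideal_gen_insert_prod assms(1) comaximal_linear_factors)
      then show ?case
        by simp
    qed
    from this[of _ UNIV] show "f \<in> ideal_gen (g ` UNIV)"
      by simp
  qed
qed

end
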